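(* Let $(d_n)_{n\in\mathbb N_0}$ be a sequence of nonnegative integers such that $d_0=1$ and $$\left\lceil \sqrt[m+1]{d_{m+1}}\,\right\rceil\le\left\lfloor\sqrt[m]{d_m}\right\rfloor$$ for all $m\ge 1$. Then there exists a word system $(X_n)_{n\in\mathbb N_0}$ (over some alphabet) with $\#X_n=d_n$ for all $n\in\mathbb N=\{1,2,\dots\}$.
   Context: For $a\in\mathbb R$, $\lceil a\rceil=\min\{n\in\mathbb Z\mid n\ge a\}$ and $\lfloor a\rfloor=\max\{n\in\mathbb Z\mid n\le a\}$. An alphabet is a set $A$. $A^n$ is the set of words of length $n$ over $A$ ($n$-tuples), $A^0=\{\Lambda\}$ with $\Lambda=()$ the empty word, and $A^*=\bigcup_{n\in\mathbb N_0}A^n$ is a monoid under concatenation. A word $y$ is a subword of $w$ if $w=xyz$ for some $x,z\in A^*$. A word system over $A$ is a family $(X_n)_{n\in\mathbb N_0}$ of subsets $X_n\subset A^n$ with $X_0=A^0$ such that whenever $w\in\bigcup_n X_n$ and $y\in A^k$ is a subword of $w$, then $y\in X_k$. *)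

theory Defs
  imports Complex_Main "HOL-Library.Sublist" "HOL-Library.NList"
begin

text \<open>
  Words are lists: \<open>nlists n A\<close> is the set \<open>A\<^sup>n\<close> of words of length \<open>n\<close> over \<open>A\<close>, and
  \<open>sublist y w\<close> states that \<open>w = x @ y @ z\<close> for some \<open>x\<close>, \<open>z\<close> (a contiguous factor). If \<open>w\<close> is a
  word over \<open>A\<close>, then so are \<open>x\<close> and \<open>z\<close>.
\<close>

definition word_system :: "'a set \<Rightarrow> (nat \<Rightarrow> 'a list set) \<Rightarrow> bool" where
  "word_system A X \<longleftrightarrow>
     (\<forall>n. X n \<subseteq> nlists n A) \<and>
     X 0 = nlists 0 A \<and>
     (\<forall>w \<in> (\<Union>n. X n). \<forall>k. \<forall>y \<in> nlists k A. sublist y w \<longrightarrow> y \<in> X k)"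

end

theory Submission
  imports Defs
begin

text \<open>
  With \<open>c\<^sub>n = \<lceil>root n d\<^sub>n\<rceil>\<close>, the hypothesis makes \<open>c\<close> nonincreasing and gives
  \<open>c\<^sub>n\<^sub>+\<^sub>1\<^sup>n \<le> d\<^sub>n \<le> c\<^sub>n\<^sup>n\<close>. Hence \<open>X\<^sub>n\<close> can be chosen of size \<open>d\<^sub>n\<close> between the
  words of length \<open>n\<close> over \<open>{0,\<dots>,c\<^sub>n\<^sub>+\<^sub>1 - 1}\<close> and those over \<open>{0,\<dots>,c\<^sub>n - 1}\<close>.
  A proper subword, of length \<open>k < n\<close>, of a word in \<open>X\<^sub>n\<close> only uses letters below
  \<open>c\<^sub>n \<le> c\<^sub>k\<^sub>+\<^sub>1\<close>, so it lies in \<open>X\<^sub>k\<close>.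
\<close>

text \<open>As conditional rewrite rules these two loop together with the definition of \<open>nlists\<close>.\<close>

declare nlistsE_length [simp del] nlistsE_set [simp del]

lemma finite_nlists: "finite A \<Longrightarrow> finite (nlists n A)"
  by (rule finite_subset[OF _ finite_lists_length_eq[of A n]]) (auto simp: nlists_def)

lemma card_nlists:
  assumes "finite A"
  shows "card (nlists n A) = card A ^ n"
proof -
  have "nlists n A = {xs. set xs \<subseteq> A \<and> length xs = n}"
    by (auto simp: nlists_def)
  then show ?thesis using card_lists_length_eq[OF assms] by simp
qed

lemma word_system_between:
  fixes C :: "nat \<Rightarrow> 'a set"
  assumes X0: "X 0 = {[]}"
    and lower: "\<And>n. n \<ge> 1 \<Longrightarrow> nlists n (C (Suc n)) \<subseteq> X n"
    and upper: "\<And>n. n \<ge> 1 \<Longrightarrow> X n \<subseteq> nlists n (C n)"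
    and anti: "\<And>n. n \<ge> 1 \<Longrightarrow> C (Suc n) \<subseteq> C n"
  shows "word_system UNIV X"
proof -
  have X_len: "length w = n" if "w \<in> X n" for w n
    using that X0 upper[of n] by (cases "n = 0") (auto simp: nlists_def)
  have C_anti: "C n \<subseteq> C m" if "1 \<le> m" "m \<le> n" for m n
    using that(2)
  proof (induction rule: dec_induct)
    case (step i)
    then show ?case using anti[of i] that(1) by simp
  qed simp
  have sub: "y \<in> X k" if w: "w \<in> X n" and y: "length y = k" "sublist y w" for n k w y
  proof -
    \<comment> \<open>A factor of full length needs its own case: \<open>X n\<close> may miss words
      over \<open>C n\<close>, but this factor is \<open>w\<close> itself. Otherwise
      \<open>Suc k \<le> n\<close>, which puts the letters of \<open>y\<close> in
      \<open>C (Suc k)\<close>.\<close>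
    consider "k = 0" | "k = n" | "k \<noteq> 0" "k \<noteq> n" by blast
    then show ?thesis
    proof cases
      case 1
      then show ?thesis using X0 y(1) by simp
    next
      case 2
      then have "y = w" using y X_len[OF w] by (auto simp: sublist_def)
      then show ?thesis using 2 w by simp
    next
      case 3
      then have k: "1 \<le> k" "k < n"
        using y X_len[OF w] sublist_length_le[OF y(2)] by auto
      have "set w \<subseteq> C n" using w upper[of n] k by (auto simp: nlists_def)
      then have "set y \<subseteq> C (Suc k)"
        using set_mono_sublist[OF y(2)] C_anti[of "Suc k" n] k by auto
      then show ?thesis using lower[OF k(1)] y(1) by (auto simp: nlists_def)
    qed
  qed
  show ?thesis
    unfolding word_system_def
  proof (intro conjI ballI allI impI)
    show "X n \<subseteq> nlists n UNIV" for n using X_len by (auto simp: nlists_def)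
    show "X 0 = nlists 0 UNIV" using X0 by (auto simp: nlists_def)
    show "y \<in> X k" if "w \<in> (\<Union>n. X n)" "y \<in> nlists k UNIV" "sublist y w" for w k y
      using that sub[of w _ y k] by (auto simp: nlists_def)
  qed
qed

lemma power_floor_root_le:
  fixes d m :: nat
  assumes "m \<ge> 1"
  shows "nat \<lfloor>root m (real d)\<rfloor> ^ m \<le> d"
proof -
  have "real (nat \<lfloor>root m (real d)\<rfloor>) ^ m \<le> root m (real d) ^ m"
    by (intro power_mono of_nat_floor real_root_ge_zero) auto
  also have "\<dots> = real d" using assms by simp
  finally show ?thesis by (simp flip: of_nat_power)
qed

lemma le_power_ceiling_root:
  fixes d m :: nat
  assumes "m \<ge> 1"
  shows "d \<le> nat \<lceil>root m (real d)\<rceil> ^ m"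
proof -
  have "real d = root m (real d) ^ m" using assms by simp
  also have "\<dots> \<le> real (nat \<lceil>root m (real d)\<rceil>) ^ m"
    by (intro power_mono real_nat_ceiling_ge real_root_ge_zero) auto
  finally show ?thesis by (simp flip: of_nat_power)
qed

theorem theorem5p7:
  fixes d :: "nat \<Rightarrow> nat"
  assumes "d 0 = 1"
    and "\<And>m. m \<ge> 1 \<Longrightarrow>
      \<lceil>root (m + 1) (real (d (m + 1)))\<rceil> \<le> \<lfloor>root m (real (d m))\<rfloor>"
  shows "\<exists>(A :: nat set) X. word_system A X \<and>
    (\<forall>n\<ge>1. finite (X n) \<and> card (X n) = d n)"
proof -
  \<comment> \<open>\<open>root 0\<close> is constantly 0, so \<open>c 0 = 0\<close>; the chain of
    bounds starts at \<open>c 1 = d 1\<close>.\<close>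
  define c where "c n = nat \<lceil>root n (real (d n))\<rceil>" for n
  have c_floor: "c (Suc n) \<le> nat \<lfloor>root n (real (d n))\<rfloor>" if "n \<ge> 1" for n
    using nat_mono[OF assms(2)[OF that]] unfolding c_def Suc_eq_plus1 .
  have c_anti: "c (Suc n) \<le> c n" if "n \<ge> 1" for n
  proof -
    note c_floor[OF that]
    also have "nat \<lfloor>root n (real (d n))\<rfloor> \<le> c n"
      unfolding c_def by (intro nat_mono floor_le_ceiling)
    finally show ?thesis .
  qed
  have lower: "c (Suc n) ^ n \<le> d n" if "n \<ge> 1" for n
    using power_mono[OF c_floor[OF that], of n] power_floor_root_le[OF that, of "d n"] by simp
  have upper: "d n \<le> c n ^ n" if "n \<ge> 1" for n
    unfolding c_def by (rule le_power_ceiling_root[OF that])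
  \<comment> \<open>The outer sets have \<open>c (Suc n) ^ n\<close> and \<open>c n ^ n\<close>
    elements, so a set of intermediate size \<open>d n\<close> fits between them.\<close>
  have "\<exists>Y. nlists n {..<c (Suc n)} \<subseteq> Y \<and> Y \<subseteq> nlists n {..<c n} \<and> card Y = d n"
    if n: "n \<ge> 1" for n
  proof -
    have "nlists n {..<c (Suc n)} \<subseteq> nlists n {..<c n}"
      using c_anti[OF n] by (auto simp: nlists_def)
    then show ?thesis
      using exists_subset_between[of "nlists n {..<c (Suc n)}" "d n" "nlists n {..<c n}"]
        lower[OF n] upper[OF n] by (auto simp: card_nlists finite_nlists)
  qed
  then obtain Y where Y: "\<And>n. n \<ge> 1 \<Longrightarrow> nlists n {..<c (Suc n)} \<subseteq> Y n"
      "\<And>n. n \<ge> 1 \<Longrightarrow> Y n \<subseteq> nlists n {..<c n}" "\<And>n. n \<ge> 1 \<Longrightarrow> card (Y n) = d n"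
    by metis
  \<comment> \<open>\<open>Y 0\<close> is arbitrary, so level 0 is set by hand.\<close>
  define X where "X n = (if n = 0 then {[]} else Y n)" for n
  have "word_system UNIV X"
    by (rule word_system_between[where C = "\<lambda>n. {..<c n}"])
      (use Y(1,2) c_anti in \<open>simp_all add: X_def\<close>)
  \<comment> \<open>Infinite sets have \<open>card\<close> 0, so for \<open>d n = 0\<close>
    finiteness must come from the upper bound on \<open>Y n\<close>.\<close>
  moreover have "finite (X n) \<and> card (X n) = d n" if "n \<ge> 1" for n
    using that Y(2,3)[OF that] finite_subset[OF Y(2)[OF that]] by (simp add: X_def finite_nlists)
  ultimately show ?thesis by blast
qed

end
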